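(* Let $A$ be any algorithm with the following properties: $A$ is given $N$, an accuracy parameter $\epsilon>0$, distinct values $0\le a_1<a_2<a_3<a_4\in\mathbb{Z}$, and access to i.i.d. draws from an unknown $\{a_1,a_2,a_3,a_4\}$-sum $\mathbf{S}^*$; and with probability at least $9/10$ algorithm $A$ outputs a hypothesis distribution $\tilde{\mathbf{S}}$ such that $d_{TV}(\tilde{\mathbf{S}},\mathbf{S}^* )\le\epsilon$. Then there are infinitely many quadruples $(a_1,a_2,a_3,a_4)$ such that for sufficiently large $N$, $A$ must use $\Omega(\log\log a_4)$ samples even when run with $\epsilon$ set to a (suitably small) positive absolute constant.
   Context: For a finite set $\mathcal{A}\subset\mathbb{Z}_{\ge 0}$, an $\mathcal{A}$-sum is a distribution $\mathbf{S}=\mathbf{X}_1+\cdots+\mathbf{X}_N$ where the $\mathbf{X}_i$ are mutually independent (not necessarily identically distributed) integer random variables with $\bigcup_i\mathrm{supp}(\mathbf{X}_i)\subseteq\mathcal{A}$. $d_{TV}$ denotes total variation distance. *)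

theory Defs
  imports "HOL-Probability.Probability"
begin

fun sum_indep_pmf :: "(nat \<Rightarrow> int pmf) \<Rightarrow> nat \<Rightarrow> int pmf" where
  "sum_indep_pmf Xs 0 = return_pmf 0"
| "sum_indep_pmf Xs (Suc n) =
     map_pmf (\<lambda>(x, y). x + y) (pair_pmf (sum_indep_pmf Xs n) (Xs n))"

definition is_A_sum :: "int set \<Rightarrow> nat \<Rightarrow> int pmf \<Rightarrow> bool" where
  "is_A_sum A N S \<longleftrightarrow>
     (\<exists>Xs. (\<forall>i<N. set_pmf (Xs i) \<subseteq> A) \<and> S = sum_indep_pmf Xs N)"

definition dTV :: "int pmf \<Rightarrow> int pmf \<Rightarrow> real" where
  "dTV p q = (\<Sum>\<^sub>\<infinity> x. \<bar>pmf p x - pmf q x\<bar>) / 2"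

fun iid_pmf :: "nat \<Rightarrow> 'a pmf \<Rightarrow> 'a list pmf" where
  "iid_pmf 0 p = return_pmf []"
| "iid_pmf (Suc m) p = bind_pmf p (\<lambda>x. map_pmf (\<lambda>xs. x # xs) (iid_pmf m p))"

text \<open>A (randomized) learning algorithm: on input (N, eps, (a1,a2,a3,a4)) it draws
  m N eps a samples and outputs a random hypothesis distribution alg N eps a samples.
  It is correct if for every valid input and every {a1..a4}-sum S with N summands,
  with probability at least 9/10 the hypothesis is eps-close to S in TV distance.\<close>
definition correct_learner ::
  "(nat \<Rightarrow> real \<Rightarrow> int \<times> int \<times> int \<times> int \<Rightarrow> nat) \<Rightarrow>
   (nat \<Rightarrow> real \<Rightarrow> int \<times> int \<times> int \<times> int \<Rightarrow> int list \<Rightarrow> int pmf pmf) \<Rightarrow> bool" where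
  "correct_learner m alg \<longleftrightarrow>
     (\<forall>N eps a1 a2 a3 a4 S.
        eps > 0 \<and> 0 \<le> a1 \<and> a1 < a2 \<and> a2 < a3 \<and> a3 < a4 \<and>
        is_A_sum {a1, a2, a3, a4} N S \<longrightarrow>
        measure_pmf.prob
          (bind_pmf (iid_pmf (m N eps (a1, a2, a3, a4)) S) (alg N eps (a1, a2, a3, a4)))
          {H. dTV H S \<le> eps} \<ge> 9 / 10)"

end

theory Submission
  imports Defs
begin

text \<open>
  Let \<open>F\<close> be the Fibonacci-like sequence with ratio about 100, and take the quadruple
  \<open>(0, 1, p, q) = (0, 1, F n, F (n + 1))\<close>. For \<open>0 < k < n\<close> the hypothesis with index \<open>k\<close> is
  \<open>U + p V + q Y\<close>, where \<open>U\<close>, \<open>V\<close>, \<open>Y\<close> are fair binomials of standard deviation about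
  \<open>F (n - k)\<close>, \<open>F k\<close>, and a huge number, respectively. The partial quotients of
  \<open>p / q\<close> are bounded, so the lattice \<open>{(u, v). q dvd u + p v}\<close> has no short vectors at any of the
  \<open>n - 1\<close> scales. This has two consequences. First, \<open>U + p V\<close> hits every residue class modulo \<open>q\<close>
  with probability \<open>O(1/q)\<close>, so, after smoothing by \<open>q Y\<close>, all hypotheses are dominated up to an
  absolute constant \<open>C\<close> by one reference distribution. Second, each hypothesis concentrates modulo
  \<open>q\<close> on a box which the hypotheses with wider \<open>U\<close> mostly miss, so the hypotheses are pairwise far
  apart. With \<open>m\<close> samples, domination bounds the sum of the success probabilities over all
  hypotheses by \<open>C ^ m\<close>; hence \<open>9/10 (n - 1) \<le> C ^ m\<close>, where \<open>n\<close> is of order \<open>ln q\<close>.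
\<close>

section \<open>Unimodality and concentration of fair binomials\<close>

text \<open>With \<open>2 * L\<^sup>2\<close> trials the mean and mode are the integer
  \<open>L\<^sup>2\<close> and the variance is \<open>L\<^sup>2 / 2\<close>, so \<open>L\<close> is
  the scale of the distribution.\<close>

definition fair_binomial :: "nat \<Rightarrow> int pmf" where
  "fair_binomial L = map_pmf int (binomial_pmf (2 * L\<^sup>2) (1/2))"

lemma pmf_fair_binomial:
  "pmf (fair_binomial L) x =
     (if x < 0 then 0 else real ((2 * L\<^sup>2) choose nat x) / 4 ^ L\<^sup>2)"
proof (cases "x < 0")
  case True
  then have "x \<notin> set_pmf (fair_binomial L)"
    unfolding fair_binomial_def by auto
  then show ?thesis using True by (simp add: set_pmf_eq)
next
  case False
  then obtain k where k: "x = int k" by (metis not_less zero_le_imp_eq_int)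
  have "pmf (fair_binomial L) x = pmf (binomial_pmf (2 * L\<^sup>2) (1/2)) k"
    unfolding fair_binomial_def k by (rule pmf_map_inj') simp
  also have "\<dots> = real ((2 * L\<^sup>2) choose k) / 4 ^ L\<^sup>2"
  proof (cases "k \<le> 2 * L\<^sup>2")
    case True
    have "(1/2::real) ^ k * (1/2) ^ (2 * L\<^sup>2 - k) = (1/2) ^ (2 * L\<^sup>2)"
      using True by (metis le_add_diff_inverse power_add)
    also have "\<dots> = 1 / 4 ^ L\<^sup>2"
      by (simp add: power_mult power2_eq_square power_divide)
    finally show ?thesis by (simp add: mult.assoc)
  qed (auto simp: binomial_eq_0)
  finally show ?thesis using k by simp
qed

lemma set_pmf_fair_binomial: "set_pmf (fair_binomial L) \<subseteq> {0..2 * (int L)\<^sup>2}"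
  unfolding fair_binomial_def by (auto simp flip: of_nat_power)

lemma finite_set_pmf_fair_binomial [simp]: "finite (set_pmf (fair_binomial L))"
  using finite_subset[OF set_pmf_fair_binomial] by blast

lemma fair_binomial_mono:
  assumes "x \<le> y" "y \<le> (int L)\<^sup>2"
  shows "pmf (fair_binomial L) x \<le> pmf (fair_binomial L) y"
proof (cases "x < 0")
  case False
  have "nat y \<le> L\<^sup>2" using assms by (simp flip: of_nat_power)
  then have "(2 * L\<^sup>2) choose nat x \<le> (2 * L\<^sup>2) choose nat y"
    using assms by (intro binomial_mono) auto
  then show ?thesis using False assms
    by (auto simp: pmf_fair_binomial divide_right_mono)
qed (simp add: pmf_fair_binomial)

lemma fair_binomial_antimono:
  assumes "x \<le> y" "(int L)\<^sup>2 \<le> x"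
  shows "pmf (fair_binomial L) y \<le> pmf (fair_binomial L) x"
proof (cases "nat y \<le> 2 * L\<^sup>2")
  case True
  have x: "L\<^sup>2 \<le> nat x" using assms(2) by (metis nat_int nat_mono of_nat_power)
  have "0 \<le> x" using assms(2) by (meson order_trans zero_le_power2)
  moreover have "(2 * L\<^sup>2) choose nat x \<ge> (2 * L\<^sup>2) choose nat y"
    using assms(1) x True by (intro binomial_antimono) auto
  ultimately show ?thesis using assms
    by (auto simp: pmf_fair_binomial divide_right_mono)
qed (auto simp: pmf_fair_binomial binomial_eq_0)

text \<open>Consecutive central coefficients have ratio \<open>2 (2 n + 1) / (n + 1)\<close>, and
  the induction closes because \<open>(2 n + 1) (2 n + 3) <= 4 (n + 1)^2\<close>. At
  \<open>n = L\<^sup>2\<close> this bounds the mode of \<open>fair_binomial L\<close> by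
  \<open>1 / L\<close>.\<close>

lemma central_binomial_upper_bound:
  "(real ((2 * n) choose n))\<^sup>2 * (2 * real n + 1) \<le> 16 ^ n"
proof (induction n)
  case (Suc n)
  have "Suc n * ((2 * Suc n) choose Suc n) = 2 * (2 * n + 1) * ((2 * n) choose n)"
  proof -
    have "Suc n * ((2 * Suc n) choose Suc n) = (2 * Suc n) * ((2 * n + 1) choose n)"
      using binomial_absorption[of n "2 * Suc n"] by (simp del: binomial_Suc_Suc)
    moreover have "Suc n * ((2 * n + 1) choose n) = (2 * n + 1) * ((2 * n) choose n)"
      using binomial_absorption[of n "2 * n + 1"] binomial_symmetric[of n "2 * n + 1"]
      by (simp del: binomial_Suc_Suc)
    ultimately have "Suc n * (Suc n * ((2 * Suc n) choose Suc n)) =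
        Suc n * (2 * (2 * n + 1) * ((2 * n) choose n))"
      by (metis (no_types, opaque_lifting) mult.assoc mult.left_commute)
    then show ?thesis by (simp only: mult_cancel1) (simp del: binomial_Suc_Suc)
  qed
  then have "real (Suc n) * real ((2 * Suc n) choose Suc n) =
      2 * (2 * real n + 1) * real ((2 * n) choose n)"
    using of_nat_mult[where 'a = real] by (metis (no_types, lifting) of_nat_1 of_nat_add of_nat_numeral)
  then have eq: "real ((2 * Suc n) choose Suc n) =
      2 * (2 * real n + 1) * real ((2 * n) choose n) / (real n + 1)"
    by (simp add: field_simps del: binomial_Suc_Suc)
  have "(real ((2 * Suc n) choose Suc n))\<^sup>2 * (2 * real (Suc n) + 1) =
      ((real ((2 * n) choose n))\<^sup>2 * (2 * real n + 1)) *
      (4 * ((2 * real n + 1) * (2 * real n + 3)) / (real n + 1)\<^sup>2)"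
    unfolding eq by (simp add: power2_eq_square field_simps del: binomial_Suc_Suc)
  also have "\<dots> \<le> 16 ^ n * 16"
  proof (rule mult_mono[OF Suc.IH])
    have "4 * ((2 * real n + 1) * (2 * real n + 3)) \<le> 16 * (real n + 1)\<^sup>2"
      by (simp add: power2_eq_square algebra_simps)
    then show "4 * ((2 * real n + 1) * (2 * real n + 3)) / (real n + 1)\<^sup>2 \<le> 16"
      by (simp add: divide_le_eq)
  qed auto
  finally show ?case by simp
qed simp

lemma fair_binomial_le:
  assumes "L > 0"
  shows "pmf (fair_binomial L) x \<le> 1 / L"
proof -
  let ?c = "real ((2 * L\<^sup>2) choose (L\<^sup>2))"
  have "(?c * L)\<^sup>2 \<le> ?c\<^sup>2 * (2 * real (L\<^sup>2) + 1)"
    by (simp add: power_mult_distrib mult_left_mono)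
  also have "\<dots> \<le> 16 ^ (L\<^sup>2)" by (rule central_binomial_upper_bound)
  also have "\<dots> = (4 ^ (L\<^sup>2))\<^sup>2" by (simp add: power2_eq_square flip: power_mult_distrib)
  finally have "?c * L \<le> 4 ^ (L\<^sup>2)" by (rule power2_le_imp_le) simp
  then have c: "?c / 4 ^ (L\<^sup>2) \<le> 1 / L" using assms by (simp add: field_simps)
  have "real ((2 * L\<^sup>2) choose nat x) \<le> ?c" using binomial_maximum' by simp
  then have "real ((2 * L\<^sup>2) choose nat x) / 4 ^ (L\<^sup>2) \<le> ?c / 4 ^ (L\<^sup>2)"
    by (intro divide_right_mono) auto
  with c show ?thesis by (simp add: pmf_fair_binomial)
qed

text \<open>Hoeffding's inequality with deviation \<open>2 L\<close> over
  \<open>2 * L\<^sup>2\<close> trials bounds the complement by \<open>2 exp (-4)\<close>.\<close>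

lemma fair_binomial_concentration:
  assumes "L > 0"
  shows "measure_pmf.prob (fair_binomial L) {(int L)\<^sup>2 - 2 * int L..(int L)\<^sup>2 + 2 * int L} \<ge> 7 / 8"
proof -
  let ?B = "binomial_pmf (2 * L\<^sup>2) (1/2)"
  interpret binomial_distribution "2 * L\<^sup>2" "1/2" by unfold_locales auto
  let ?A = "{x. \<bar>real x - real (2 * L\<^sup>2) * (1/2)\<bar> \<ge> 2 * real L}"
  have "measure_pmf.prob ?B ?A \<le> 2 * exp (-2 * (2 * real L)\<^sup>2 / real (2 * L\<^sup>2))"
    using prob_abs_ge[of "2 * real L"] assms by simp
  also have "-2 * (2 * real L)\<^sup>2 / real (2 * L\<^sup>2) = -4"
    using assms by (simp add: power2_eq_square field_simps)
  also have "2 * exp (-4 :: real) \<le> 1 / 8"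
  proof -
    have "2 ^ 4 \<le> exp (1::real) ^ 4" using exp_ge_add_one_self[of 1] by (intro power_mono) auto
    then have "16 \<le> exp (4::real)" by (simp flip: exp_of_nat_mult)
    then show ?thesis by (simp add: exp_minus field_simps)
  qed
  finally have *: "measure_pmf.prob ?B ?A \<le> 1 / 8" .
  have "7 / 8 \<le> measure_pmf.prob ?B (- ?A)"
    using * measure_pmf.prob_compl[of ?A ?B] by (simp add: Compl_eq_Diff_UNIV)
  also have "\<dots> \<le> measure_pmf.prob ?B
      (int -` {(int L)\<^sup>2 - 2 * int L..(int L)\<^sup>2 + 2 * int L})"
  proof (rule measure_pmf.finite_measure_mono)
    show "- ?A \<subseteq> int -` {(int L)\<^sup>2 - 2 * int L..(int L)\<^sup>2 + 2 * int L}"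
    proof
      fix x assume "x \<in> - ?A"
      then have "\<bar>real x - (real L)\<^sup>2\<bar> < 2 * real L" by simp
      then have "\<bar>real_of_int (int x - (int L)\<^sup>2)\<bar> < real_of_int (2 * int L)" by simp
      then have "\<bar>int x - (int L)\<^sup>2\<bar> < 2 * int L" by linarith
      then show "x \<in> int -` {(int L)\<^sup>2 - 2 * int L..(int L)\<^sup>2 + 2 * int L}" by auto
    qed
  qed simp
  finally show ?thesis by (simp add: fair_binomial_def)
qed

section \<open>Mass of separated sets\<close>

lemma prob_eq_sum_support:
  assumes "finite (set_pmf P)"
  shows "measure_pmf.prob P A = (\<Sum>x\<in>A \<inter> set_pmf P. pmf P x)"
  using assms measure_measure_pmf_finite[of "A \<inter> set_pmf P" P]
  by (simp add: measure_Int_set_pmf)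

text \<open>By separation the \<open>l\<close> translates of \<open>W\<close> by
  \<open>d * t\<close> are disjoint, and each weighs at least as much as \<open>W\<close>; together
  they weigh at most 1.\<close>

lemma prob_le_of_translates:
  fixes P :: "int pmf" and l d :: int
  assumes fin: "finite (set_pmf P)" and l: "0 < l" and d: "\<bar>d\<bar> = 1"
    and sep: "\<And>x y. x \<in> W \<Longrightarrow> y \<in> W \<Longrightarrow> x \<noteq> y \<Longrightarrow> l \<le> \<bar>x - y\<bar>"
    and le: "\<And>z t. z \<in> W \<Longrightarrow> 0 \<le> t \<Longrightarrow> t < l \<Longrightarrow> pmf P z \<le> pmf P (z + d * t)"
  shows "measure_pmf.prob P W \<le> 1 / l"
proof -
  define W' where "W' = W \<inter> set_pmf P"
  have W': "finite W'" "W' \<subseteq> W" using fin by (auto simp: W'_def)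
  define h where "h = (\<lambda>(z, t). z + d * t)"
  have inj: "inj_on h (W' \<times> {0..<l})"
  proof (rule inj_onI)
    fix x y assume x: "x \<in> W' \<times> {0..<l}" and y: "y \<in> W' \<times> {0..<l}" and eq: "h x = h y"
    obtain z t z' t' where [simp]: "x = (z, t)" "y = (z', t')" by (cases x, cases y)
    have e: "z - z' = d * (t' - t)" using eq by (simp add: h_def algebra_simps)
    then have "\<bar>z - z'\<bar> = \<bar>t' - t\<bar>" using d by (simp add: abs_mult)
    also have "\<dots> < l" using x y by auto
    finally have "z = z'" using sep[of z z'] x y W' by force
    then show "x = y" using e d by auto
  qed
  have "real_of_int l * measure_pmf.prob P W = (\<Sum>z\<in>W'. \<Sum>t\<in>{0..<l}. pmf P z)"
    using l by (simp add: prob_eq_sum_support[OF fin] W'_def sum_distrib_left)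
  also have "\<dots> \<le> (\<Sum>z\<in>W'. \<Sum>t\<in>{0..<l}. pmf P (h (z, t)))"
    using W' le by (intro sum_mono) (auto simp: h_def)
  also have "\<dots> = (\<Sum>x\<in>W' \<times> {0..<l}. pmf P (h x))"
    by (simp add: sum.cartesian_product)
  also have "\<dots> = (\<Sum>x\<in>h ` (W' \<times> {0..<l}). pmf P x)"
    using sum.reindex[OF inj, of "pmf P"] by simp
  also have "\<dots> = measure_pmf.prob P (h ` (W' \<times> {0..<l}))"
    using W' by (simp add: measure_measure_pmf_finite)
  also have "\<dots> \<le> 1" by simp
  finally show ?thesis using l by (simp add: field_simps)
qed

text \<open>Translating towards the mode never decreases the mass. Points that \<open>l - 1\<close>
  steps would carry past the mode cannot be handled so, but separation leaves at most one of them on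
  each side, of mass at most \<open>1 / L\<close>.\<close>

lemma fair_binomial_separated:
  fixes l :: int
  assumes L: "0 < L" and l: "0 < l"
    and sep: "\<And>x y. x \<in> Z \<Longrightarrow> y \<in> Z \<Longrightarrow> x \<noteq> y \<Longrightarrow> l \<le> \<bar>x - y\<bar>"
  shows "measure_pmf.prob (fair_binomial L) Z \<le> 2 / l + 2 / L"
proof -
  let ?P = "fair_binomial L" and ?c = "(int L)\<^sup>2"
  have single: "measure_pmf.prob ?P M \<le> 1 / L" if "\<And>x y. x \<in> M \<Longrightarrow> y \<in> M \<Longrightarrow> x = y" for M
  proof (cases "M = {}")
    case False
    then obtain x where "x \<in> M" by blast
    with that have "M = {x}" by blast
    then show ?thesis using fair_binomial_le[OF L, of x] by (simp add: measure_pmf_single)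
  qed simp
  \<comment> \<open>The shifts run up to \<open>l - 1\<close>, hence the offsets by one.
    \<open>M\<close> and \<open>N\<close> lie in windows of fewer than \<open>l\<close> integers,
    just below and just above the mode.\<close>
  define A B M N where "A = {z \<in> Z. z + l \<le> ?c + 1}" and "B = {z \<in> Z. ?c - 1 \<le> z - l}"
    and "M = {z \<in> Z. ?c + 1 < z + l \<and> z \<le> ?c}" and "N = {z \<in> Z. ?c < z \<and> z - l < ?c - 1}"
  have "Z \<subseteq> A \<union> B \<union> (M \<union> N)" by (auto simp: A_def B_def M_def N_def)
  then have "measure_pmf.prob ?P Z \<le> measure_pmf.prob ?P (A \<union> B \<union> (M \<union> N))"
    by (intro measure_pmf.finite_measure_mono) auto
  also have "\<dots> \<le> (measure_pmf.prob ?P A + measure_pmf.prob ?P B) +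
      (measure_pmf.prob ?P M + measure_pmf.prob ?P N)"
    using measure_Un_le[of "A \<union> B" ?P "M \<union> N"] measure_Un_le[of A ?P B] measure_Un_le[of M ?P N]
    by simp
  also have "measure_pmf.prob ?P A \<le> 1 / l"
  proof (rule prob_le_of_translates[where d = 1])
    fix z t assume "z \<in> A" "0 \<le> t" "t < l"
    then show "pmf ?P z \<le> pmf ?P (z + 1 * t)"
      by (intro fair_binomial_mono) (auto simp: A_def)
  qed (use l sep in \<open>auto simp: A_def\<close>)
  also have "measure_pmf.prob ?P B \<le> 1 / l"
  proof (rule prob_le_of_translates[where d = "-1"])
    fix z t assume "z \<in> B" "0 \<le> t" "t < l"
    then show "pmf ?P z \<le> pmf ?P (z + (-1) * t)"
      by (intro fair_binomial_antimono) (auto simp: B_def)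
  qed (use l sep in \<open>auto simp: B_def\<close>)
  also have "measure_pmf.prob ?P M \<le> 1 / L"
    by (rule single) (use sep in \<open>fastforce simp: M_def\<close>)
  also have "measure_pmf.prob ?P N \<le> 1 / L"
    by (rule single) (use sep in \<open>fastforce simp: N_def\<close>)
  finally show ?thesis by simp
qed

lemma fair_binomial_separated_intervals:
  fixes l w :: int
  assumes L: "0 < L" and l: "0 < l" and w: "0 \<le> w"
    and sep: "\<And>x y. x \<in> Z \<Longrightarrow> y \<in> Z \<Longrightarrow> x \<noteq> y \<Longrightarrow> l \<le> \<bar>x - y\<bar>"
  shows "measure_pmf.prob (fair_binomial L) (\<Union>t\<in>{0..<w}. (\<lambda>z. z + t) ` Z) \<le> w * (2 / l + 2 / L)"
proof -
  let ?P = "fair_binomial L"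
  have "measure_pmf.prob ?P (\<Union>t\<in>{0..<w}. (\<lambda>z. z + t) ` Z) \<le>
      (\<Sum>t\<in>{0..<w}. measure_pmf.prob ?P ((\<lambda>z. z + t) ` Z))"
    by (rule measure_UNION_le) auto
  also have "\<dots> \<le> (\<Sum>t\<in>{0..<w}. 2 / l + 2 / L)"
    by (intro sum_mono fair_binomial_separated L l) (use sep in auto)
  also have "\<dots> = w * (2 / l + 2 / L)" using w by simp
  finally show ?thesis .
qed

text \<open>Within a block of \<open>l'\<close> consecutive values of \<open>v\<close> the first coordinates of \<open>D\<close> are
  \<open>l\<close>-separated; the maximisers over blocks of equal parity are \<open>l'\<close>-separated.\<close>
lemma pair_fair_binomial_le:
  fixes l l' :: int
  assumes L: "0 < L" "0 < L'" and l: "0 < l" "0 < l'"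
    and sep: "\<And>u v u' v'. (u, v) \<in> D \<Longrightarrow> (u', v') \<in> D \<Longrightarrow> \<bar>u - u'\<bar> < l \<Longrightarrow> \<bar>v - v'\<bar> < l' \<Longrightarrow>
      u = u' \<and> v = v'"
  shows "measure_pmf.prob (pair_pmf (fair_binomial L) (fair_binomial L')) D \<le>
    2 * (2 / l + 2 / L) * (2 / l' + 2 / L')"
proof -
  let ?U = "fair_binomial L" and ?V = "fair_binomial L'"
  define E where "E = D \<inter> set_pmf ?U \<times> set_pmf ?V"
  have E: "finite E" "E \<subseteq> D" by (auto simp: E_def)
  define blk where "blk = (\<lambda>x :: int \<times> int. snd x div l')"
  define C where "C b = {x \<in> E. blk x = b}" for b
  have C: "finite (C b)" "C b \<subseteq> D" for b using E by (auto simp: C_def)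
  have blk_close: "\<bar>v - v'\<bar> < l'" if "v div l' = v' div l'" for v v'
  proof -
    have "v - v' = v mod l' - v' mod l'"
      using that by (metis add_diff_cancel_left mult_div_mod_eq)
    moreover have "0 \<le> v mod l'" "v mod l' < l'" "0 \<le> v' mod l'" "v' mod l' < l'"
      using l by auto
    ultimately show ?thesis by linarith
  qed
  have blk_far: "l' \<le> \<bar>v - v'\<bar>" if "even (v div l') = even (v' div l')" "v div l' \<noteq> v' div l'" for v v'
  proof -
    define b where "b = v div l' - v' div l'"
    have "even b" "b \<noteq> 0" using that by (auto simp: b_def)
    then have "2 \<le> \<bar>b\<bar>" by presburger
    then have "2 * l' \<le> \<bar>b\<bar> * l'" using l by (intro mult_right_mono) auto
    then have "2 * l' \<le> \<bar>l' * b\<bar>" using l by (simp add: abs_mult mult.commute)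
    moreover have "v - v' = l' * b + (v mod l' - v' mod l')"
      by (simp add: b_def algebra_simps)
    moreover have "0 \<le> v mod l'" "v mod l' < l'" "0 \<le> v' mod l'" "v' mod l' < l'"
      using l by auto
    ultimately show ?thesis by linarith
  qed
  have "\<exists>v. v \<in> snd ` C b \<and> (\<forall>x\<in>C b. pmf ?V (snd x) \<le> pmf ?V v)" if "b \<in> blk ` E" for b
  proof -
    have "C b \<noteq> {}" using that by (auto simp: C_def)
    then have "Max ((\<lambda>x. pmf ?V (snd x)) ` C b) \<in> (\<lambda>x. pmf ?V (snd x)) ` C b"
      using C by (intro Max_in) auto
    then obtain x where "x \<in> C b" "pmf ?V (snd x) = Max ((\<lambda>x. pmf ?V (snd x)) ` C b)" by auto
    then show ?thesis using C by (intro exI[of _ "snd x"]) auto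
  qed
  then obtain vm where vm: "\<And>b. b \<in> blk ` E \<Longrightarrow> vm b \<in> snd ` C b"
      "\<And>b x. b \<in> blk ` E \<Longrightarrow> x \<in> C b \<Longrightarrow> pmf ?V (snd x) \<le> pmf ?V (vm b)"
    by metis
  have vm_div: "vm b div l' = b" if "b \<in> blk ` E" for b
    using vm(1)[OF that] by (auto simp: C_def blk_def)
  have row: "(\<Sum>x\<in>C b. pmf ?U (fst x)) \<le> 2 / l + 2 / L" for b
  proof -
    have close: "x = y" if "x \<in> C b" "y \<in> C b" "\<bar>fst x - fst y\<bar> < l" for x y
    proof -
      have "\<bar>snd x - snd y\<bar> < l'" using that by (intro blk_close) (auto simp: C_def blk_def)
      then show ?thesis using sep[of "fst x" "snd x" "fst y" "snd y"] that C(2)[of b]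
        by (auto simp: prod_eq_iff)
    qed
    have inj: "inj_on fst (C b)" by (rule inj_onI) (use close l in auto)
    have "(\<Sum>x\<in>C b. pmf ?U (fst x)) = measure_pmf.prob ?U (fst ` C b)"
      using C by (simp add: measure_measure_pmf_finite sum.reindex[OF inj])
    also have "\<dots> \<le> 2 / l + 2 / L"
      by (rule fair_binomial_separated[OF L(1) l(1)]) (use close in force)
    finally show ?thesis .
  qed
  have col: "(\<Sum>b\<in>{b \<in> blk ` E. even b = e}. pmf ?V (vm b)) \<le> 2 / l' + 2 / L'" for e
  proof -
    let ?B = "{b \<in> blk ` E. even b = e}"
    have inj: "inj_on vm ?B" by (rule inj_on_inverseI[of _ "\<lambda>v. v div l'"]) (use vm_div in blast)
    have "(\<Sum>b\<in>?B. pmf ?V (vm b)) = measure_pmf.prob ?V (vm ` ?B)"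
      using E by (simp add: measure_measure_pmf_finite sum.reindex[OF inj])
    also have "\<dots> \<le> 2 / l' + 2 / L'"
    proof (rule fair_binomial_separated[OF L(2) l(2)])
      fix x y assume "x \<in> vm ` ?B" "y \<in> vm ` ?B" "x \<noteq> y"
      then show "l' \<le> \<bar>x - y\<bar>" by (intro blk_far) (auto simp: vm_div)
    qed
    finally show ?thesis .
  qed
  have nn: "0 \<le> 2 / l + 2 / L" using l by simp
  have "measure_pmf.prob (pair_pmf ?U ?V) D = (\<Sum>x\<in>E. pmf ?U (fst x) * pmf ?V (snd x))"
    by (simp add: prob_eq_sum_support E_def) (auto intro!: sum.cong simp: pmf_pair)
  also have "\<dots> = (\<Sum>b\<in>blk ` E. \<Sum>x\<in>C b. pmf ?U (fst x) * pmf ?V (snd x))"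
    unfolding C_def by (rule sum.image_gen[OF E(1)])
  \<comment> \<open>Replacing the \<open>V\<close>-mass by its maximum over the block decouples the
    coordinates: each block contributes a row sum over \<open>U\<close> times a single value of
    \<open>V\<close>.\<close>
  also have "\<dots> \<le> (\<Sum>b\<in>blk ` E. (\<Sum>x\<in>C b. pmf ?U (fst x)) * pmf ?V (vm b))"
    unfolding sum_distrib_right by (intro sum_mono mult_left_mono vm(2)) auto
  also have "\<dots> \<le> (\<Sum>b\<in>blk ` E. (2 / l + 2 / L) * pmf ?V (vm b))"
    by (intro sum_mono mult_right_mono row) auto
  also have "\<dots> = (2 / l + 2 / L) * (\<Sum>b\<in>blk ` E. pmf ?V (vm b))"
    by (simp add: sum_distrib_left)
  \<comment> \<open>Maximisers of adjacent blocks may be close, so the parities are bounded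
    separately; this costs the factor 2.\<close>
  also have "(\<Sum>b\<in>blk ` E. pmf ?V (vm b)) =
      (\<Sum>b\<in>{b \<in> blk ` E. even b = True}. pmf ?V (vm b)) +
      (\<Sum>b\<in>{b \<in> blk ` E. even b = False}. pmf ?V (vm b))"
    using E by (subst sum.union_disjoint[symmetric]) (auto intro!: sum.cong)
  also have "(2 / l + 2 / L) * \<dots> \<le> (2 / l + 2 / L) * ((2 / l' + 2 / L') + (2 / l' + 2 / L'))"
    by (intro mult_left_mono add_mono col nn)
  finally show ?thesis by (simp add: algebra_simps)
qed

section \<open>A lattice without short vectors\<close>

text \<open>The coefficient 100 sets the gap between consecutive scales: it yields
  \<open>4 * fib_like k < fib_like (Suc k)\<close> for positive \<open>k\<close> and the overlap
  bound \<open>1 / 5\<close> in \<open>hypothesis_other_event\<close>.\<close>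

fun fib_like :: "nat \<Rightarrow> int" where
  "fib_like 0 = 0"
| "fib_like (Suc 0) = 1"
| "fib_like (Suc (Suc n)) = 100 * fib_like (Suc n) + fib_like n"

lemma fib_like_nonneg: "0 \<le> fib_like n"
  by (induction n rule: fib_like.induct) auto

lemma fib_like_Suc_bounds:
  shows "100 * fib_like n \<le> fib_like (Suc n)"
    and "0 < n \<Longrightarrow> fib_like (Suc n) \<le> 101 * fib_like n"
    and "0 < fib_like (Suc n)"
proof -
  have *: "100 * fib_like n \<le> fib_like (Suc n) \<and> 0 < fib_like (Suc n)" for n
  proof (induction n)
    case (Suc n)
    then show ?case using fib_like_nonneg[of n] by simp
  qed simp
  then show "100 * fib_like n \<le> fib_like (Suc n)" "0 < fib_like (Suc n)" by auto
  show "fib_like (Suc n) \<le> 101 * fib_like n" if "0 < n"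
    using that *[of "n - 2"] *[of "n - 1"] fib_like_nonneg[of "n - 2"]
    by (cases n rule: fib_like.cases) auto
qed

lemma fib_like_pos: "0 < n \<Longrightarrow> 0 < fib_like n"
  using fib_like_Suc_bounds(3)[of "n - 1"] by simp

lemma strict_mono_fib_like: "strict_mono fib_like"
proof (rule strict_mono_Suc_iff[THEN iffD2], rule allI)
  fix n show "fib_like n < fib_like (Suc n)"
    using fib_like_Suc_bounds(1,3)[of n] fib_like_nonneg[of n] by linarith
qed

text \<open>With \<open>m = n - k\<close> this writes \<open>q = fib_like (Suc n)\<close> as the
  determinant, up to sign, of two consecutive lattice vectors. It also makes \<open>q\<close>
  comparable to the product of the two scales of a hypothesis.\<close>

lemma fib_like_add:
  "fib_like (m + Suc k) = fib_like (Suc m) * fib_like (Suc k) + fib_like m * fib_like k"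
proof (induction k rule: fib_like.induct)
  case (3 k)
  then show ?case by (simp add: algebra_simps)
qed auto

text \<open>This puts the vector \<open>((-1) ^ k * F (n + 1 - k), F k)\<close> into the lattice.
  Both summands satisfy the recurrence of \<open>fib_like\<close> in \<open>k\<close>, the
  alternating sign making up for the reversed index, so the cases 0 and 1 suffice.\<close>

lemma fib_like_cong:
  assumes "k \<le> Suc n"
  shows "fib_like (Suc n) dvd fib_like n * fib_like k + (-1) ^ k * fib_like (Suc n - k)"
  using assms
proof (induction k rule: fib_like.induct)
  case (3 k)
  obtain j where j: "Suc n = Suc (Suc k) + j" using 3 by (metis le_Suc_ex)
  have s: "fib_like (Suc n - k) = 100 * fib_like (Suc n - Suc k) + fib_like (Suc n - Suc (Suc k))"
  proof -
    have "Suc n - k = Suc (Suc j)" "Suc n - Suc k = Suc j" "Suc n - Suc (Suc k) = j"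
      using j by auto
    then show ?thesis by simp
  qed
  have "fib_like n * fib_like (Suc (Suc k)) + (-1) ^ Suc (Suc k) * fib_like (Suc n - Suc (Suc k))
    = 100 * (fib_like n * fib_like (Suc k) + (-1) ^ Suc k * fib_like (Suc n - Suc k))
      + (fib_like n * fib_like k + (-1) ^ k * fib_like (Suc n - k))"
    unfolding s by (simp add: algebra_simps)
  moreover have "fib_like (Suc n) dvd \<dots>"
    by (intro dvd_add dvd_mult 3) (use 3 in auto)
  ultimately show ?case by metis
qed auto

text \<open>The coordinates \<open>\<alpha>\<close>, \<open>\<beta>\<close> of \<open>(u, v)\<close> in the lattice basis
  \<open>((-1) ^ i * F (n + 1 - i), F i)\<close>, \<open>i = k, k + 1\<close>, are integers by Cramer's rule. The signs in
  this basis alternate, so \<open>\<alpha>\<close> and \<open>\<beta>\<close> of equal sign force \<open>v\<close>, and of opposite sign force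
  \<open>u\<close>, to be large.\<close>
lemma fib_like_lattice:
  assumes k: "k \<le> n"
    and dvd: "fib_like (Suc n) dvd u + fib_like n * v"
    and v: "\<bar>v\<bar> < fib_like (Suc k)"
    and u: "\<bar>u\<bar> < fib_like (Suc n - k)"
  shows "u = 0 \<and> v = 0"
proof -
  define q where "q = fib_like (Suc n)"
  define p where "p = fib_like n"
  define a b where "a = fib_like k" and "b = fib_like (Suc k)"
  define c d where "c = fib_like (Suc n - k)" and "d = fib_like (Suc n - Suc k)"
  define w where "w = (-1) ^ k * u"
  have nn: "0 \<le> a" "0 \<le> d" "0 < b" "0 < c" "0 < q"
    using k by (auto simp: a_def d_def b_def c_def q_def fib_like_nonneg fib_like_pos)
  have det: "q = c * b + d * a"
    using fib_like_add[of "n - k" k] k by (simp add: q_def c_def b_def d_def a_def Suc_diff_le)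
  have w_abs: "\<bar>w\<bar> < c" using u by (simp add: w_def c_def abs_mult)
  have sq: "(-1) ^ k * (-1) ^ k = (1::int)" by (simp flip: power_mult_distrib)
  have cong_a: "q dvd p * a + (-1) ^ k * c"
    unfolding q_def p_def a_def c_def by (rule fib_like_cong) (use k in auto)
  have cong_b: "q dvd p * b - (-1) ^ k * d"
    using fib_like_cong[of "Suc k" n] k by (simp add: q_def p_def b_def d_def)
  have dvd': "q dvd u + p * v" using dvd by (simp add: q_def p_def)
  \<comment> \<open>Eliminating \<open>p\<close> between \<open>(u, v)\<close> and the basis vector
    of index \<open>k + 1\<close> leaves the Cramer numerator \<open>b * w + v * d\<close>. It is a
    multiple of \<open>q\<close>, the basis determinant up to sign, so the coordinate is an integer.
    The other coordinate is treated alike with index \<open>k\<close>.\<close>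
  have "q dvd (-1) ^ k * (b * (u + p * v) - v * (p * b - (-1) ^ k * d))"
    by (intro dvd_mult dvd_diff dvd' cong_b)
  also have "(-1) ^ k * (b * (u + p * v) - v * (p * b - (-1) ^ k * d)) =
      b * w + ((-1) ^ k * (-1) ^ k) * (v * d)"
    by (simp add: w_def algebra_simps)
  finally obtain \<alpha> where \<alpha>: "b * w + v * d = q * \<alpha>" unfolding sq by auto
  have "q dvd (-1) ^ k * (v * (p * a + (-1) ^ k * c) - a * (u + p * v))"
    by (intro dvd_mult dvd_diff dvd' cong_a)
  also have "(-1) ^ k * (v * (p * a + (-1) ^ k * c) - a * (u + p * v)) =
      ((-1) ^ k * (-1) ^ k) * (v * c) - a * w"
    by (simp add: w_def algebra_simps)
  finally obtain \<beta> where \<beta>: "v * c - a * w = q * \<beta>" unfolding sq by auto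
  have "q * v = a * (q * \<alpha>) + b * (q * \<beta>)"
    unfolding \<alpha>[symmetric] \<beta>[symmetric] by (simp add: det algebra_simps)
  then have "q * v = q * (a * \<alpha> + b * \<beta>)" by (simp add: algebra_simps)
  then have v_eq: "v = a * \<alpha> + b * \<beta>" using nn by simp
  have "q * w = c * (q * \<alpha>) - d * (q * \<beta>)"
    unfolding \<alpha>[symmetric] \<beta>[symmetric] by (simp add: det algebra_simps)
  then have "q * w = q * (c * \<alpha> - d * \<beta>)" by (simp add: algebra_simps)
  then have w_eq: "w = c * \<alpha> - d * \<beta>" using nn by simp
  have v_abs: "\<bar>v\<bar> < b" using v by (simp add: b_def)
  have ge1: "x * y \<ge> x" if "y \<ge> 1" "x \<ge> 0" for x y :: int
    using mult_left_mono[of 1 y x] that by simp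
  have le1: "x * y \<le> - x" if "y \<le> -1" "x \<ge> 0" for x y :: int
    using mult_left_mono[of y "-1" x] that by simp
  have nonneg: "x * y \<ge> 0" if "y \<ge> 0" "x \<ge> 0" for x y :: int using that by simp
  have nonpos: "x * y \<le> 0" if "y \<le> 0" "x \<ge> 0" for x y :: int
    using that by (simp add: mult_nonneg_nonpos)
  have "\<alpha> = 0"
  proof (rule ccontr)
    assume "\<alpha> \<noteq> 0"
    then consider "\<alpha> \<ge> 1" "\<beta> \<ge> 1" | "\<alpha> \<ge> 1" "\<beta> \<le> 0" | "\<alpha> \<le> -1" "\<beta> \<ge> 0" | "\<alpha> \<le> -1" "\<beta> \<le> -1"
      by linarith
    then show False
    proof cases
      case 1 then show ?thesis using ge1[of \<beta> b] nonneg[of \<alpha> a] nn v_abs v_eq by linarith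
    next
      case 2 then show ?thesis using ge1[of \<alpha> c] nonpos[of \<beta> d] nn w_abs w_eq by linarith
    next
      case 3 then show ?thesis using le1[of \<alpha> c] nonneg[of \<beta> d] nn w_abs w_eq by linarith
    next
      case 4 then show ?thesis using le1[of \<beta> b] nonpos[of \<alpha> a] nn v_abs v_eq by linarith
    qed
  qed
  moreover have "\<beta> = 0"
  proof (rule ccontr)
    assume "\<beta> \<noteq> 0"
    then consider "\<beta> \<ge> 1" | "\<beta> \<le> -1" by linarith
    then show False
      using ge1[of \<beta> b] le1[of \<beta> b] \<open>\<alpha> = 0\<close> nn v_abs v_eq by cases auto
  qed
  ultimately show ?thesis using v_eq w_eq by (simp add: w_def)
qed

lemma fib_like_le_power: "fib_like n \<le> 101 ^ n"
proof (induction n)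
  case (Suc n)
  then show ?case using fib_like_Suc_bounds(2)[of n] by (cases n) auto
qed simp

section \<open>Total variation and learning dominated hypotheses\<close>

lemma pmf_summable_on: "pmf p summable_on A"
  using abs_summable_equivalent[of "pmf p" A] pmf_abs_summable[of p A] by simp

lemma prob_eq_infsum: "measure_pmf.prob p A = infsum (pmf p) A"
  using infsetsum_infsum[OF pmf_abs_summable] by (simp add: measure_pmf_conv_infsetsum)

lemma abs_pmf_diff_summable_on: "(\<lambda>x. \<bar>pmf p x - pmf q x\<bar>) summable_on A"
proof (rule summable_on_comparison_test)
  show "(\<lambda>x. pmf p x + pmf q x) summable_on A"
    by (intro summable_on_add pmf_summable_on)
qed (auto simp: abs_if)

lemma dTV_commute: "dTV p q = dTV q p"
  unfolding dTV_def by (simp add: abs_minus_commute)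

lemma dTV_triangle: "dTV p r \<le> dTV p q + dTV q r"
proof -
  have "(\<Sum>\<^sub>\<infinity>x. \<bar>pmf p x - pmf r x\<bar>) \<le> (\<Sum>\<^sub>\<infinity>x. \<bar>pmf p x - pmf q x\<bar> + \<bar>pmf q x - pmf r x\<bar>)"
    by (intro infsum_mono summable_on_add abs_pmf_diff_summable_on) auto
  also have "\<dots> = (\<Sum>\<^sub>\<infinity>x. \<bar>pmf p x - pmf q x\<bar>) + (\<Sum>\<^sub>\<infinity>x. \<bar>pmf q x - pmf r x\<bar>)"
    by (intro infsum_add abs_pmf_diff_summable_on)
  finally show ?thesis unfolding dTV_def by simp
qed

text \<open>The excess of \<open>p\<close> over \<open>q\<close> on \<open>A\<close> equals its
  deficit on the complement, so twice the difference is covered by the l1 distance split over the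
  two sets.\<close>

lemma dTV_ge_prob_diff: "measure_pmf.prob p A - measure_pmf.prob q A \<le> dTV p q"
proof -
  have le: "measure_pmf.prob p B - measure_pmf.prob q B \<le> (\<Sum>\<^sub>\<infinity>x\<in>B. \<bar>pmf p x - pmf q x\<bar>)" for p q B
  proof -
    have "measure_pmf.prob p B \<le> (\<Sum>\<^sub>\<infinity>x\<in>B. pmf q x + \<bar>pmf p x - pmf q x\<bar>)"
      unfolding prob_eq_infsum
      by (intro infsum_mono summable_on_add pmf_summable_on abs_pmf_diff_summable_on) auto
    also have "\<dots> = measure_pmf.prob q B + (\<Sum>\<^sub>\<infinity>x\<in>B. \<bar>pmf p x - pmf q x\<bar>)"
      unfolding prob_eq_infsum by (intro infsum_add pmf_summable_on abs_pmf_diff_summable_on)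
    finally show ?thesis by simp
  qed
  have "2 * (measure_pmf.prob p A - measure_pmf.prob q A) =
      (measure_pmf.prob p A - measure_pmf.prob q A) +
      (measure_pmf.prob q (- A) - measure_pmf.prob p (- A))"
    using measure_pmf.prob_compl[of A p] measure_pmf.prob_compl[of A q]
    by (simp add: Compl_eq_Diff_UNIV)
  also have "\<dots> \<le> (\<Sum>\<^sub>\<infinity>x\<in>A. \<bar>pmf p x - pmf q x\<bar>) + (\<Sum>\<^sub>\<infinity>x\<in>- A. \<bar>pmf q x - pmf p x\<bar>)"
    by (intro add_mono le)
  also have "\<dots> = (\<Sum>\<^sub>\<infinity>x\<in>A \<union> - A. \<bar>pmf p x - pmf q x\<bar>)"
    by (subst infsum_Un_disjoint) (auto simp: abs_pmf_diff_summable_on abs_minus_commute)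
  finally show ?thesis unfolding dTV_def by simp
qed

section \<open>Domination of samples and of learner outputs\<close>

lemma iid_pmf_Suc_pair: "iid_pmf (Suc m) p = map_pmf (\<lambda>(x, xs). x # xs) (pair_pmf p (iid_pmf m p))"
  by (simp add: pair_pmf_def map_pmf_def bind_assoc_pmf bind_return_pmf)

lemma pmf_iid_Suc_Cons: "pmf (iid_pmf (Suc m) p) (x # xs) = pmf p x * pmf (iid_pmf m p) xs"
proof -
  have "inj (\<lambda>(x, xs). x # xs)" by (auto simp: inj_on_def)
  from pmf_map_inj'[OF this, of "pair_pmf p (iid_pmf m p)" "(x, xs)"] show ?thesis
    unfolding iid_pmf_Suc_pair by (simp add: pmf_pair)
qed

lemma iid_pmf_dominated:
  assumes "0 \<le> C" "\<And>x. pmf p x \<le> C * pmf r x"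
  shows "pmf (iid_pmf m p) xs \<le> C ^ m * pmf (iid_pmf m r) xs"
proof (induction m arbitrary: xs)
  case (Suc m)
  show ?case
  proof (cases xs)
    case Nil
    have "[] \<notin> set_pmf (iid_pmf (Suc m) p)" by auto
    then show ?thesis using assms(1) Nil by (simp add: set_pmf_eq del: iid_pmf.simps)
  next
    case (Cons y ys)
    have "pmf p y * pmf (iid_pmf m p) ys \<le> (C * pmf r y) * (C ^ m * pmf (iid_pmf m r) ys)"
      using assms Suc.IH by (intro mult_mono) auto
    then show ?thesis unfolding Cons pmf_iid_Suc_Cons by (simp add: algebra_simps)
  qed
qed simp

text \<open>Pointwise domination passes through any random kernel \<open>g\<close>; here
  \<open>g\<close> is the learner, with its internal randomness.\<close>

lemma bind_pmf_dominated:
  assumes C: "0 \<le> C" and le: "\<And>x. pmf p x \<le> C * pmf r x"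
  shows "measure_pmf.prob (bind_pmf p g) A \<le> C * measure_pmf.prob (bind_pmf r g) A"
proof -
  have "emeasure (bind_pmf p g) A = (\<integral>\<^sup>+x. ennreal (pmf p x) * emeasure (g x) A \<partial>count_space UNIV)"
    by (simp add: nn_integral_measure_pmf)
  also have "\<dots> \<le> (\<integral>\<^sup>+x. ennreal C * (ennreal (pmf r x) * emeasure (g x) A) \<partial>count_space UNIV)"
  proof (rule nn_integral_mono)
    fix x
    have "ennreal (pmf p x) \<le> ennreal C * ennreal (pmf r x)"
      using le[of x] C by (simp add: ennreal_leI flip: ennreal_mult)
    then show "ennreal (pmf p x) * emeasure (g x) A \<le> ennreal C * (ennreal (pmf r x) * emeasure (g x) A)"
      by (simp add: mult_right_mono flip: mult.assoc)
  qed
  also have "\<dots> = ennreal C * emeasure (bind_pmf r g) A"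
    by (simp add: nn_integral_measure_pmf nn_integral_cmult)
  finally show ?thesis using C
    by (simp add: measure_pmf.emeasure_eq_measure del: emeasure_bind_pmf flip: ennreal_mult)
qed

text \<open>Since the success events are disjoint, dominating all hypotheses by one reference
  distribution \<open>R\<close> up to a factor \<open>C\<close> bounds the total success probability by \<open>C ^ m\<close>.\<close>
lemma learning_many_dominated_hypotheses:
  fixes S :: "'i \<Rightarrow> int pmf" and alg :: "int list \<Rightarrow> int pmf pmf"
  assumes fin: "finite I" and C: "0 \<le> C"
    and dom: "\<And>i x. i \<in> I \<Longrightarrow> pmf (S i) x \<le> C * pmf R x"
    and far: "\<And>i j. i \<in> I \<Longrightarrow> j \<in> I \<Longrightarrow> i \<noteq> j \<Longrightarrow> 2 * eps < dTV (S i) (S j)"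
    and succ: "\<And>i. i \<in> I \<Longrightarrow>
      \<delta> \<le> measure_pmf.prob (bind_pmf (iid_pmf m (S i)) alg) {H. dTV H (S i) \<le> eps}"
  shows "\<delta> * card I \<le> C ^ m"
proof -
  let ?G = "\<lambda>i. {H. dTV H (S i) \<le> eps}" and ?R = "bind_pmf (iid_pmf m R) alg"
  have disj: "disjoint_family_on ?G I"
    unfolding disjoint_family_on_def
  proof (intro ballI impI)
    fix i j assume ij: "i \<in> I" "j \<in> I" "i \<noteq> j"
    have "False" if "dTV H (S i) \<le> eps" "dTV H (S j) \<le> eps" for H
      using far[OF ij] dTV_triangle[of "S i" "S j" H] dTV_commute[of "S i" H] that by linarith
    then show "?G i \<inter> ?G j = {}" by blast
  qed
  have "\<delta> * card I = (\<Sum>i\<in>I. \<delta>)" by simp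
  also have "\<dots> \<le> (\<Sum>i\<in>I. C ^ m * measure_pmf.prob ?R (?G i))"
  proof (rule sum_mono)
    fix i assume i: "i \<in> I"
    have "\<delta> \<le> measure_pmf.prob (bind_pmf (iid_pmf m (S i)) alg) (?G i)" by (rule succ[OF i])
    also have "\<dots> \<le> C ^ m * measure_pmf.prob ?R (?G i)"
      using C dom[OF i] by (intro bind_pmf_dominated iid_pmf_dominated) auto
    finally show "\<delta> \<le> C ^ m * measure_pmf.prob ?R (?G i)" .
  qed
  also have "\<dots> = C ^ m * measure_pmf.prob ?R (\<Union>i\<in>I. ?G i)"
    using measure_pmf.finite_measure_finite_Union[OF fin _ disj, of ?R]
    by (simp add: sum_distrib_left)
  also have "\<dots> \<le> C ^ m" using C by (simp add: mult_left_le)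
  finally show ?thesis .
qed

section \<open>Sums of scaled binomials\<close>

lemma sum_indep_pmf_cong:
  "(\<And>i. i < n \<Longrightarrow> Xs i = Ys i) \<Longrightarrow> sum_indep_pmf Xs n = sum_indep_pmf Ys n"
  by (induction n) auto

lemma sum_indep_pmf_add:
  "sum_indep_pmf Xs (m + n) =
    map_pmf (\<lambda>(x, y). x + y) (pair_pmf (sum_indep_pmf Xs m) (sum_indep_pmf (\<lambda>i. Xs (m + i)) n))"
proof (induction n)
  case 0
  show ?case by (simp add: pair_return_pmf2 pmf.map_comp o_def)
next
  case (Suc n)
  then show ?case
    by (simp add: pair_pmf_def map_pmf_def bind_assoc_pmf bind_return_pmf add.assoc)
qed

lemma is_A_sum_add:
  assumes "is_A_sum A m S" "is_A_sum A n T"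
  shows "is_A_sum A (m + n) (map_pmf (\<lambda>(x, y). x + y) (pair_pmf S T))"
proof -
  obtain Xs Ys where X: "\<And>i. i < m \<Longrightarrow> set_pmf (Xs i) \<subseteq> A" "S = sum_indep_pmf Xs m"
    and Y: "\<And>i. i < n \<Longrightarrow> set_pmf (Ys i) \<subseteq> A" "T = sum_indep_pmf Ys n"
    using assms unfolding is_A_sum_def by blast
  define Zs where "Zs i = (if i < m then Xs i else Ys (i - m))" for i
  have "sum_indep_pmf Zs m = S" unfolding X(2) by (rule sum_indep_pmf_cong) (simp add: Zs_def)
  moreover have "sum_indep_pmf (\<lambda>i. Zs (m + i)) n = T" unfolding Y(2) by (simp add: Zs_def)
  moreover have "set_pmf (Zs i) \<subseteq> A" if "i < m + n" for i
    using that X(1)[of i] Y(1)[of "i - m"] by (auto simp: Zs_def)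
  ultimately show ?thesis unfolding is_A_sum_def using sum_indep_pmf_add[of Zs m n] by metis
qed

text \<open>Zero summands pad a combination to exactly \<open>N\<close> terms, so one family of
  hypotheses serves all large \<open>N\<close>.\<close>

lemma is_A_sum_return_0: "0 \<in> A \<Longrightarrow> is_A_sum A n (return_pmf 0)"
proof -
  have "sum_indep_pmf (\<lambda>_. return_pmf 0) n = return_pmf 0" by (induction n) auto
  then show "0 \<in> A \<Longrightarrow> is_A_sum A n (return_pmf 0)"
    unfolding is_A_sum_def by (intro exI[of _ "\<lambda>_. return_pmf 0"]) auto
qed

lemma is_A_sum_fair_binomial:
  assumes "0 \<in> A" "a \<in> A"
  shows "is_A_sum A (2 * L\<^sup>2) (map_pmf ((*) a) (fair_binomial L))"
proof -
  define coin :: "int pmf" where "coin = map_pmf (\<lambda>b. if b then a else 0) (bernoulli_pmf (1/2))"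
  have "sum_indep_pmf (\<lambda>_. coin) n = map_pmf (\<lambda>k. a * int k) (binomial_pmf n (1/2))" for n
  proof (induction n)
    case 0
    show ?case by (simp add: binomial_pmf_0)
  next
    case (Suc n)
    show ?case
      unfolding sum_indep_pmf.simps Suc.IH
      \<comment> \<open>The recursion of \<open>binomial_pmf\<close> draws the new coin first, that
        of \<open>sum_indep_pmf\<close> draws it last.\<close>
      by (subst pair_commute_pmf)
         (auto simp: binomial_pmf_Suc coin_def pair_pmf_def map_pmf_def bind_assoc_pmf
           bind_return_pmf algebra_simps intro!: bind_pmf_cong)
  qed
  then have "sum_indep_pmf (\<lambda>_. coin) (2 * L\<^sup>2) = map_pmf ((*) a) (fair_binomial L)"
    by (simp add: fair_binomial_def pmf.map_comp o_def)
  moreover have "set_pmf coin \<subseteq> A" using assms by (auto simp: coin_def)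
  ultimately show ?thesis unfolding is_A_sum_def by metis
qed

text \<open>\<open>u\<close> is drawn last so that a bound over \<open>U\<close> alone, uniform in
  \<open>v\<close> and \<open>y\<close>, carries over to the mixture.
  \<open>binomial_combination_pair\<close> draws \<open>y\<close> last instead, as domination
  requires.\<close>

definition binomial_combination :: "int \<Rightarrow> int \<Rightarrow> nat \<Rightarrow> nat \<Rightarrow> nat \<Rightarrow> int pmf" where
  "binomial_combination p q L M K =
    bind_pmf (fair_binomial M) (\<lambda>v. bind_pmf (fair_binomial K) (\<lambda>y.
      map_pmf (\<lambda>u. u + p * v + q * y) (fair_binomial L)))"

lemma binomial_combination_pair:
  "binomial_combination p q L M K =
    bind_pmf (pair_pmf (fair_binomial L) (fair_binomial M))
      (\<lambda>(u, v). map_pmf (\<lambda>y. u + p * v + q * y) (fair_binomial K))"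
proof -
  let ?U = "fair_binomial L" and ?V = "fair_binomial M" and ?Y = "fair_binomial K"
  have "binomial_combination p q L M K =
      bind_pmf ?V (\<lambda>v. bind_pmf ?U (\<lambda>u. bind_pmf ?Y (\<lambda>y. return_pmf (u + p * v + q * y))))"
    unfolding binomial_combination_def map_pmf_def by (subst bind_commute_pmf) simp
  also have "\<dots> = bind_pmf ?U (\<lambda>u. bind_pmf ?V (\<lambda>v. bind_pmf ?Y (\<lambda>y. return_pmf (u + p * v + q * y))))"
    by (rule bind_commute_pmf)
  finally show ?thesis
    by (simp add: pair_pmf_def map_pmf_def bind_assoc_pmf bind_return_pmf)
qed

lemma is_A_sum_binomial_combination:
  assumes "2 * L\<^sup>2 + 2 * M\<^sup>2 + 2 * K\<^sup>2 \<le> N"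
  shows "is_A_sum {0, 1, p, q} N (binomial_combination p q L M K)"
proof -
  let ?A = "{0, 1, p, q}" and ?add = "\<lambda>S T. map_pmf (\<lambda>(x, y). x + y) (pair_pmf S T)"
  let ?b = "\<lambda>a L. map_pmf ((*) a) (fair_binomial L)"
  have "is_A_sum ?A (2 * L\<^sup>2 + 2 * M\<^sup>2 + 2 * K\<^sup>2 + (N - (2 * L\<^sup>2 + 2 * M\<^sup>2 + 2 * K\<^sup>2)))
      (?add (?add (?add (?b 1 L) (?b p M)) (?b q K)) (return_pmf 0))"
    by (intro is_A_sum_add is_A_sum_fair_binomial is_A_sum_return_0) auto
  moreover have "?add (?add (?add (?b 1 L) (?b p M)) (?b q K)) (return_pmf 0) = binomial_combination p q L M K"
    unfolding binomial_combination_pair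
    by (simp add: pair_pmf_def map_pmf_def bind_assoc_pmf bind_return_pmf)
  ultimately show ?thesis using assms by simp
qed

text \<open>One distribution must dominate all shifts by at most \<open>J\<close>. Up to the mode
  the unshifted copy does so, beyond the mode plus \<open>J\<close> the copy shifted by
  \<open>J\<close>, and between them the uniform distribution on \<open>J + 1\<close> points, whose
  mass \<open>1 / (J + 1)\<close> bounds any value of the binomial. The factor 4 comes from the
  weights 1/2, 1/4, 1/4.\<close>

lemma fair_binomial_window_dominated:
  "\<exists>Q :: int pmf. \<forall>y j. 0 \<le> j \<and> j \<le> int J \<longrightarrow> pmf (fair_binomial (Suc J)) (y - j) \<le> 4 * pmf Q y"
proof -
  let ?Y = "fair_binomial (Suc J)" and ?c = "(int (Suc J))\<^sup>2"
  define A where "A = map_pmf (\<lambda>x. x + int J) ?Y"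
  define B where "B = pmf_of_set {?c..?c + int J}"
  define Q where "Q = bind_pmf (bernoulli_pmf (1/2)) (\<lambda>b. if b then ?Y else
    bind_pmf (bernoulli_pmf (1/2)) (\<lambda>b. if b then A else B))"
  have Q: "4 * pmf Q y = 2 * pmf ?Y y + pmf A y + pmf B y" for y
    by (simp add: Q_def pmf_bind field_simps)
  have A: "pmf A y = pmf ?Y (y - int J)" for y
    using pmf_map_inj'[of "\<lambda>x. x + int J" ?Y "y - int J"] by (simp add: A_def inj_def)
  have "pmf ?Y (y - j) \<le> 4 * pmf Q y" if j: "0 \<le> j" "j \<le> int J" for y j
  proof -
    consider "y \<le> ?c" | "?c \<le> y - int J" | "y \<in> {?c..?c + int J}" by fastforce
    then show ?thesis
    proof cases
      case 1
      then have "pmf ?Y (y - j) \<le> pmf ?Y y" using j by (intro fair_binomial_mono) auto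
      then show ?thesis unfolding Q using pmf_nonneg[of ?Y y] pmf_nonneg[of A y] pmf_nonneg[of B y]
        by linarith
    next
      case 2
      then have "pmf ?Y (y - j) \<le> pmf A y"
        unfolding A using j by (intro fair_binomial_antimono) auto
      then show ?thesis unfolding Q using pmf_nonneg[of ?Y y] pmf_nonneg[of B y] by linarith
    next
      case 3
      have "pmf B y = indicator {?c..?c + int J} y / real (card {?c..?c + int J})"
        unfolding B_def by (rule pmf_of_set) auto
      also have "\<dots> = 1 / real (Suc J)" using 3 by (simp add: nat_add_distrib)
      finally have "pmf ?Y (y - j) \<le> pmf B y" using fair_binomial_le[of "Suc J"] by simp
      then show ?thesis unfolding Q using pmf_nonneg[of ?Y y] pmf_nonneg[of A y] by linarith
    qed
  qed
  then show ?thesis by blast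
qed

lemma pmf_map_ge: "pmf M z \<le> pmf (map_pmf f M) (f z)"
proof -
  have "pmf M z = measure_pmf.prob M {z}" by (simp add: measure_pmf_single)
  also have "\<dots> \<le> measure_pmf.prob M (f -` {f z})"
    by (intro measure_pmf.finite_measure_mono) auto
  also have "\<dots> = pmf (map_pmf f M) (f z)" by (simp add: pmf_map)
  finally show ?thesis .
qed

text \<open>Split \<open>x\<close> into residue and quotient modulo \<open>q\<close>. The residue of
  \<open>u + p * v\<close> matches with probability at most \<open>\<kappa> / q\<close>; then
  \<open>y\<close> is \<open>x div q\<close> minus a shift in \<open>[0, J]\<close>, which
  \<open>Q\<close> absorbs. \<open>R\<close> joins a uniform residue to \<open>Q\<close> and is
  fixed before \<open>L\<close>, \<open>M\<close> and \<open>\<kappa>\<close>, so it serves all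
  hypotheses at once.\<close>

lemma binomial_combination_dominated:
  fixes p q :: int and J :: nat
  assumes q: "0 < q" and p: "0 \<le> p"
  obtains R where "\<forall>L M \<kappa> x. 2 * (int L)\<^sup>2 + p * (2 * (int M)\<^sup>2) \<le> int J \<longrightarrow>
    (\<forall>s. measure_pmf.prob (pair_pmf (fair_binomial L) (fair_binomial M))
      {(u, v). q dvd s - (u + p * v)} \<le> \<kappa> / q) \<longrightarrow>
    pmf (binomial_combination p q L M (Suc J)) x \<le> 4 * \<kappa> * pmf R x"
proof -
  let ?Y = "fair_binomial (Suc J)"
  obtain Q where Q: "\<And>y j. 0 \<le> j \<Longrightarrow> j \<le> int J \<Longrightarrow> pmf ?Y (y - j) \<le> 4 * pmf Q y"
    using fair_binomial_window_dominated[of J] by auto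
  define R where "R = map_pmf (\<lambda>(s, y). s + q * y) (pair_pmf (pmf_of_set {0..<q}) Q)"
  have R: "pmf Q (x div q) / q \<le> pmf R x" for x
  proof -
    have "pmf (pmf_of_set {0..<q}) (x mod q) = 1 / q"
      using q by (subst pmf_of_set) auto
    then show ?thesis
      using pmf_map_ge[of "pair_pmf (pmf_of_set {0..<q}) Q" "(x mod q, x div q)" "\<lambda>(s, y). s + q * y"]
      by (simp add: R_def pmf_pair)
  qed
  show ?thesis
  proof (rule that, intro allI impI)
    fix L M \<kappa> x
    assume J: "2 * (int L)\<^sup>2 + p * (2 * (int M)\<^sup>2) \<le> int J"
      and res: "\<forall>s. measure_pmf.prob (pair_pmf (fair_binomial L) (fair_binomial M))
        {(u, v). q dvd s - (u + p * v)} \<le> \<kappa> / q"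
    let ?UV = "pair_pmf (fair_binomial L) (fair_binomial M)"
    let ?D = "{(u, v). q dvd x - (u + p * v)}"
    have point: "pmf (map_pmf (\<lambda>y. u + p * v + q * y) ?Y) x \<le> 4 * pmf Q (x div q) * indicator ?D (u, v)"
      if "(u, v) \<in> set_pmf ?UV" for u v
    proof (cases "q dvd x - (u + p * v)")
      case False
      then have "x \<notin> set_pmf (map_pmf (\<lambda>y. u + p * v + q * y) ?Y)" by auto
      then show ?thesis by (simp add: set_pmf_eq)
    next
      case True
      then obtain y where "x - (u + p * v) = q * y" by blast
      then have x: "x = u + p * v + q * y" by simp
      have u: "0 \<le> u" "u \<le> 2 * (int L)\<^sup>2" and v: "0 \<le> v" "v \<le> 2 * (int M)\<^sup>2"
        using that set_pmf_fair_binomial[of L] set_pmf_fair_binomial[of M] by auto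
      have w: "0 \<le> u + p * v" using u v p by simp
      have "p * v \<le> p * (2 * (int M)\<^sup>2)" using v p by (intro mult_left_mono) auto
      then have w': "u + p * v \<le> int J" using u J by linarith
      have "(u + p * v) div q \<le> u + p * v"
        using div_le_dividend[of "nat (u + p * v)" "nat q"] w q by (simp flip: nat_div_distrib')
      then have j: "0 \<le> (u + p * v) div q" "(u + p * v) div q \<le> int J"
        using w w' q by (auto simp: pos_imp_zdiv_nonneg_iff)
      have "pmf (map_pmf (\<lambda>y. u + p * v + q * y) ?Y) x = pmf ?Y y"
        unfolding x using pmf_map_inj'[of "\<lambda>y. u + p * v + q * y" ?Y y] q by (simp add: inj_def)
      also have "y = x div q - (u + p * v) div q" using q by (simp add: x)
      also have "pmf ?Y \<dots> \<le> 4 * pmf Q (x div q)" by (rule Q[OF j])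
      finally show ?thesis using True by simp
    qed
    have "pmf (binomial_combination p q L M (Suc J)) x =
        measure_pmf.expectation ?UV (\<lambda>z. pmf (case z of (u, v) \<Rightarrow> map_pmf (\<lambda>y. u + p * v + q * y) ?Y) x)"
      unfolding binomial_combination_pair by (rule pmf_bind)
    also have "\<dots> \<le> measure_pmf.expectation ?UV (\<lambda>z. 4 * pmf Q (x div q) * indicator ?D z)"
      using point
      by (intro integral_mono_AE integrable_measure_pmf_finite) (auto simp: AE_measure_pmf_iff)
    also have "\<dots> = 4 * pmf Q (x div q) * measure_pmf.prob ?UV ?D" by simp
    also have "\<dots> \<le> 4 * pmf Q (x div q) * (\<kappa> / q)"
      using res by (intro mult_left_mono) auto
    also have "\<dots> = 4 * \<kappa> * (pmf Q (x div q) / q)" by simp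
    also have "\<dots> \<le> 4 * \<kappa> * pmf R x"
    proof (intro mult_left_mono R)
      have "0 \<le> \<kappa> / q" by (rule order_trans[OF measure_nonneg res[rule_format]])
      then show "0 \<le> 4 * \<kappa>" using q by (simp add: zero_le_divide_iff)
    qed
    finally show "pmf (binomial_combination p q L M (Suc J)) x \<le> 4 * \<kappa> * pmf R x" .
  qed
qed

section \<open>The family of hypotheses\<close>

lemma prob_bind_pmf_le:
  assumes b: "0 \<le> b" and le: "\<And>x. measure_pmf.prob (g x) A \<le> b"
  shows "measure_pmf.prob (bind_pmf p g) A \<le> b"
proof -
  have "emeasure (bind_pmf p g) A \<le> (\<integral>\<^sup>+x. ennreal b \<partial>measure_pmf p)"
    unfolding emeasure_bind_pmf
    by (intro nn_integral_mono) (simp add: measure_pmf.emeasure_eq_measure le ennreal_leI)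
  also have "\<dots> = ennreal b" by (simp add: measure_pmf.emeasure_space_1)
  finally show ?thesis
    using b by (simp add: measure_pmf.emeasure_eq_measure del: emeasure_bind_pmf)
qed

text \<open>The product of the scales of \<open>U\<close> and \<open>V\<close> is of order
  \<open>q\<close> for every \<open>0 < k < n\<close>: just enough to spread over all residues
  modulo \<open>q\<close>.\<close>

definition hypothesis :: "nat \<Rightarrow> nat \<Rightarrow> nat \<Rightarrow> int pmf" where
  "hypothesis n K k =
    binomial_combination (fib_like n) (fib_like (Suc n)) (nat (fib_like (n - k))) (nat (fib_like k)) K"

text \<open>Two points of the event differ by a lattice vector, so \<open>fib_like_lattice\<close>
  supplies the separation for \<open>pair_fair_binomial_le\<close>. The result is
  \<open>32 / (a * b)\<close>, and \<open>a * b\<close> is at least \<open>q / 10202\<close> because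
  one step of the sequence multiplies by at most 101.\<close>

lemma fib_like_residue_le:
  assumes k: "0 < k" "k < n"
  shows "measure_pmf.prob
      (pair_pmf (fair_binomial (nat (fib_like (n - k)))) (fair_binomial (nat (fib_like k))))
      {(u, v). fib_like (Suc n) dvd s - (u + fib_like n * v)} \<le> 326464 / fib_like (Suc n)"
proof -
  let ?q = "fib_like (Suc n)"
  let ?D = "{(u, v). ?q dvd s - (u + fib_like n * v)}"
  define a b where "a = real_of_int (fib_like (n - k))" and "b = real_of_int (fib_like k)"
  define a' b' where "a' = real_of_int (fib_like (Suc n - k))" and "b' = real_of_int (fib_like (Suc k))"
  have Sucs: "Suc n - k = Suc (n - k)" using k by simp
  have pos: "0 < fib_like (n - k)" "0 < fib_like k" "0 < fib_like (Suc n - k)" "0 < fib_like (Suc k)"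
    using k by (auto intro!: fib_like_pos)
  then have pos': "0 < a" "0 < b" "0 < a'" "0 < b'" by (auto simp: a_def b_def a'_def b'_def)
  have ge: "fib_like (n - k) \<le> fib_like (Suc n - k)" "fib_like k \<le> fib_like (Suc k)"
    using strict_mono_fib_like by (auto simp: strict_mono_less_eq)
  then have ge': "a \<le> a'" "b \<le> b'" by (auto simp: a_def b_def a'_def b'_def)
  have "fib_like (Suc n - k) \<le> 101 * fib_like (n - k)" "fib_like (Suc k) \<le> 101 * fib_like k"
    using fib_like_Suc_bounds(2)[of "n - k"] fib_like_Suc_bounds(2)[of k] k unfolding Sucs by auto
  then have le': "a' \<le> 101 * a" "b' \<le> 101 * b" by (auto simp: a_def b_def a'_def b'_def)
  have "?q = fib_like (Suc n - k) * fib_like (Suc k) + fib_like (n - k) * fib_like k"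
    using fib_like_add[of "n - k" k] k unfolding Sucs by simp
  then have q: "real_of_int ?q = a' * b' + a * b" by (simp add: a_def b_def a'_def b'_def)
  also have "a' * b' \<le> (101 * a) * (101 * b)" using le' pos' by (intro mult_mono) auto
  finally have q_le: "real_of_int ?q \<le> 10202 * (a * b)" by simp
  have "measure_pmf.prob
      (pair_pmf (fair_binomial (nat (fib_like (n - k)))) (fair_binomial (nat (fib_like k)))) ?D \<le>
      2 * (2 / fib_like (Suc n - k) + 2 / nat (fib_like (n - k))) *
        (2 / fib_like (Suc k) + 2 / nat (fib_like k))"
  proof (rule pair_fair_binomial_le)
    fix u v u' v'
    assume "(u, v) \<in> ?D" "(u', v') \<in> ?D" and u: "\<bar>u - u'\<bar> < fib_like (Suc n - k)"
      and v: "\<bar>v - v'\<bar> < fib_like (Suc k)"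
    then have "?q dvd (s - (u' + fib_like n * v')) - (s - (u + fib_like n * v))"
      by (intro dvd_diff[of _ "s - _" "s - _"]) auto
    then have "?q dvd (u - u') + fib_like n * (v - v')" by (simp add: algebra_simps)
    from fib_like_lattice[OF _ this v u] show "u = u' \<and> v = v'" using k by simp
  qed (use pos in auto)
  also have "\<dots> = 2 * (2 / a' + 2 / a) * (2 / b' + 2 / b)"
    using pos by (simp add: a_def b_def a'_def b'_def)
  also have "\<dots> \<le> 2 * (4 / a) * (4 / b)"
  proof (intro mult_mono)
    have "2 / a' \<le> 2 / a" "2 / b' \<le> 2 / b" using ge' pos' by (auto intro!: divide_left_mono)
    then show "2 / a' + 2 / a \<le> 4 / a" "2 / b' + 2 / b \<le> 4 / b" by auto
  qed (use pos' in auto)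
  also have "\<dots> = 32 / (a * b)" by simp
  \<comment> \<open>\<open>326464 = 32 * (101\<^sup>2 + 1)\<close>\<close>
  also have "\<dots> \<le> 326464 / fib_like (Suc n)"
    using q_le pos' fib_like_pos[of "Suc n"] by (simp add: field_simps)
  finally show ?thesis .
qed

text \<open>The concentration boxes of \<open>U\<close> and \<open>V\<close>, read modulo
  \<open>q\<close> so that the summand \<open>q * y\<close> has no influence.\<close>

definition typical_event :: "nat \<Rightarrow> nat \<Rightarrow> int set" where
  "typical_event n k = {x. \<exists>u v.
    \<bar>u - (fib_like (n - k))\<^sup>2\<bar> \<le> 2 * fib_like (n - k) \<and> \<bar>v - (fib_like k)\<^sup>2\<bar> \<le> 2 * fib_like k \<and>
    fib_like (Suc n) dvd x - (u + fib_like n * v)}"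

text \<open>Independent \<open>U\<close> and \<open>V\<close> each hit their box with probability at
  least \<open>7 / 8\<close>, and the event is invariant under adding multiples of
  \<open>q\<close>.\<close>

lemma hypothesis_typical_event:
  assumes k: "0 < k" "k < n"
  shows "49 / 64 \<le> measure_pmf.prob (hypothesis n K k) (typical_event n k)"
proof -
  let ?E = "typical_event n k"
  let ?L = "nat (fib_like (n - k))" and ?M = "nat (fib_like k)"
  let ?U = "fair_binomial ?L" and ?V = "fair_binomial ?M"
  let ?I = "\<lambda>L. {(int L)\<^sup>2 - 2 * int L..(int L)\<^sup>2 + 2 * int L}"
  have pos: "0 < fib_like (n - k)" "0 < fib_like k" using k by (auto intro!: fib_like_pos)
  have "49 / 64 = 7 / 8 * (7 / 8 :: real)" by simp
  also have "\<dots> \<le> measure_pmf.prob ?U (?I ?L) * measure_pmf.prob ?V (?I ?M)"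
    using pos by (intro mult_mono fair_binomial_concentration) auto
  also have "\<dots> = measure_pmf.prob (pair_pmf ?U ?V) (?I ?L \<times> ?I ?M)"
    by (rule measure_pmf_prob_product[symmetric]) auto
  also have "\<dots> \<le> measure_pmf.prob (hypothesis n K k) ?E"
  proof -
    have one: "measure_pmf.prob (map_pmf (\<lambda>y. u + fib_like n * v + fib_like (Suc n) * y)
        (fair_binomial K)) ?E = 1" if "(u, v) \<in> ?I ?L \<times> ?I ?M" for u v
    proof -
      have "(\<lambda>y. u + fib_like n * v + fib_like (Suc n) * y) -` ?E = UNIV"
      proof -
        have "u + fib_like n * v + fib_like (Suc n) * y \<in> ?E" for y
          unfolding typical_event_def mem_Collect_eq
          using that pos by (intro exI[of _ u] exI[of _ v]) (auto simp del: fib_like.simps)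
        then show ?thesis by auto
      qed
      then show ?thesis by (simp del: fib_like.simps)
    qed
    have "emeasure (pair_pmf ?U ?V) (?I ?L \<times> ?I ?M) =
        (\<integral>\<^sup>+z. indicator (?I ?L \<times> ?I ?M) z \<partial>pair_pmf ?U ?V)" by simp
    also have "\<dots> \<le> emeasure (hypothesis n K k) ?E"
      unfolding hypothesis_def binomial_combination_pair emeasure_bind_pmf
    proof (rule nn_integral_mono)
      fix z
      show "indicator (?I ?L \<times> ?I ?M) z \<le> emeasure (measure_pmf (case z of (u, v) \<Rightarrow>
          map_pmf (\<lambda>y. u + fib_like n * v + fib_like (Suc n) * y) (fair_binomial K))) ?E"
        using one[of "fst z" "snd z"]
        by (cases "z \<in> ?I ?L \<times> ?I ?M")
           (auto simp: measure_pmf.emeasure_eq_measure split_beta simp del: fib_like.simps)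
    qed
    finally show ?thesis by (simp add: measure_pmf.emeasure_eq_measure)
  qed
  finally show ?thesis .
qed

text \<open>For fixed \<open>v\<close> and \<open>y\<close>, the favourable \<open>u\<close> lie in
  intervals of \<open>4 * r + 1\<close> integers whose left ends are at least
  \<open>l >= 100 * r\<close> apart by the lattice property. As \<open>j < k\<close>, the scale of
  \<open>U\<close> is at least \<open>l\<close> too, so \<open>U\<close> hits these intervals with
  probability at most \<open>5 r * 4 / (100 r)\<close>.\<close>

lemma hypothesis_other_event:
  assumes k: "0 < j" "j < k" "k < n"
  shows "measure_pmf.prob (hypothesis n K j) (typical_event n k) \<le> 1 / 5"
  unfolding hypothesis_def binomial_combination_def
proof (intro prob_bind_pmf_le)
  fix v y
  let ?q = "fib_like (Suc n)" and ?p = "fib_like n"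
  let ?P = "fair_binomial (nat (fib_like (n - j)))"
  define r l where "r = fib_like (n - k)" and "l = fib_like (Suc n - k)"
  \<comment> \<open>\<open>Z\<close> holds the left ends of these intervals, one for each admissible
    \<open>v'\<close> and each residue representative.\<close>
  define Z where "Z = {z. \<exists>v'. \<bar>v' - (fib_like k)\<^sup>2\<bar> \<le> 2 * fib_like k \<and>
    ?q dvd z - (r\<^sup>2 - 2 * r) + ?p * (v - v')}"
  have Sucs: "Suc n - k = Suc (n - k)" using k by simp
  have r: "0 < r" using k by (auto simp: r_def intro!: fib_like_pos)
  have l: "100 * r \<le> l" using fib_like_Suc_bounds(1)[of "n - k"] unfolding r_def l_def Sucs .
  have "fib_like (Suc n - k) \<le> fib_like (n - j)"
    using strict_mono_fib_like k by (auto simp: strict_mono_less_eq)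
  with l have Lj: "100 * r \<le> fib_like (n - j)" by (simp add: l_def)
  \<comment> \<open>\<open>4 * fib_like k\<close> is the width of the box for \<open>v'\<close>;
    being below \<open>fib_like (Suc k)\<close>, it lets \<open>fib_like_lattice\<close> apply to
    differences.\<close>
  have Fk: "4 * fib_like k < fib_like (Suc k)"
    using fib_like_Suc_bounds(1)[of k] fib_like_pos[of k] k by simp
  have sub: "(\<lambda>u. u + ?p * v + ?q * y) -` typical_event n k \<subseteq> (\<Union>t\<in>{0..<4 * r + 1}. (\<lambda>z. z + t) ` Z)"
  proof
    fix u assume "u \<in> (\<lambda>u. u + ?p * v + ?q * y) -` typical_event n k"
    then obtain u' v' where u': "\<bar>u' - r\<^sup>2\<bar> \<le> 2 * r" and v': "\<bar>v' - (fib_like k)\<^sup>2\<bar> \<le> 2 * fib_like k"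
      and d: "?q dvd u + ?p * v + ?q * y - (u' + ?p * v')"
      unfolding typical_event_def r_def by auto
    define t where "t = u' - (r\<^sup>2 - 2 * r)"
    have t: "t \<in> {0..<4 * r + 1}" using u' by (auto simp: t_def)
    have "?q dvd (u + ?p * v + ?q * y - (u' + ?p * v')) - ?q * y"
      by (rule dvd_diff[OF d]) simp
    then have "?q dvd (u - t) - (r\<^sup>2 - 2 * r) + ?p * (v - v')" by (simp add: t_def algebra_simps)
    then have "u - t \<in> Z" using v' unfolding Z_def by blast
    then show "u \<in> (\<Union>t\<in>{0..<4 * r + 1}. (\<lambda>z. z + t) ` Z)" using t
      by (intro UN_I[of t] image_eqI[of _ _ "u - t"]) auto
  qed
  have "measure_pmf.prob (map_pmf (\<lambda>u. u + ?p * v + ?q * y) ?P) (typical_event n k) \<le>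
      measure_pmf.prob ?P (\<Union>t\<in>{0..<4 * r + 1}. (\<lambda>z. z + t) ` Z)"
    unfolding measure_map_pmf by (rule measure_pmf.finite_measure_mono[OF sub]) simp
  also have "\<dots> \<le> (4 * r + 1) * (2 / l + 2 / nat (fib_like (n - j)))"
  proof (rule fair_binomial_separated_intervals)
    fix z z' assume "z \<in> Z" "z' \<in> Z" and ne: "z \<noteq> z'"
    then obtain w w' where w: "\<bar>w - (fib_like k)\<^sup>2\<bar> \<le> 2 * fib_like k" "\<bar>w' - (fib_like k)\<^sup>2\<bar> \<le> 2 * fib_like k"
      and d: "?q dvd z - (r\<^sup>2 - 2 * r) + ?p * (v - w)" "?q dvd z' - (r\<^sup>2 - 2 * r) + ?p * (v - w')"
      unfolding Z_def by blast
    have "?q dvd (z - z') + ?p * (w' - w)"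
      using dvd_diff[OF d] by (simp add: algebra_simps)
    moreover have "\<bar>w' - w\<bar> < fib_like (Suc k)" using w Fk by linarith
    ultimately show "l \<le> \<bar>z - z'\<bar>"
      using fib_like_lattice[of k n "z - z'" "w' - w"] ne k unfolding l_def by fastforce
  qed (use r l Lj in auto)
  also have "\<dots> \<le> (5 * real_of_int r) * (2 / (100 * real_of_int r) + 2 / (100 * real_of_int r))"
  proof (rule mult_mono)
    show "real_of_int (4 * r + 1) \<le> 5 * real_of_int r" using r by simp
    have "100 * real_of_int r \<le> l" "100 * real_of_int r \<le> nat (fib_like (n - j))"
      using l Lj by linarith+
    then show "2 / real_of_int l + 2 / real (nat (fib_like (n - j))) \<le>
        2 / (100 * real_of_int r) + 2 / (100 * real_of_int r)"
      using r by (intro add_mono divide_left_mono mult_pos_pos) auto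
  qed (use r l in auto)
  also have "\<dots> = 1 / 5" using r by simp
  finally show "measure_pmf.prob (map_pmf (\<lambda>u. u + ?p * v + ?q * y) ?P) (typical_event n k) \<le> 1 / 5" .
qed auto

text \<open>By symmetry let \<open>j < k\<close>. The typical event of \<open>k\<close>, the
  hypothesis with narrower \<open>U\<close>, separates the two, since
  \<open>49 / 64 - 1 / 5 > 1 / 5\<close>.\<close>

lemma hypothesis_far:
  assumes "j \<in> {0<..<n}" "k \<in> {0<..<n}" "j \<noteq> k"
  shows "2 * (1 / 10) < dTV (hypothesis n K j) (hypothesis n K k)"
proof -
  have "2 * (1 / 10) < dTV (hypothesis n K k) (hypothesis n K j)" if "0 < j" "j < k" "k < n" for j k
    using hypothesis_typical_event[of k n K] hypothesis_other_event[OF that, of K]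
      dTV_ge_prob_diff[of "hypothesis n K k" "typical_event n k" "hypothesis n K j"] that
    by linarith
  then show ?thesis using assms dTV_commute by (metis greaterThanLessThan_iff nat_neq_iff)
qed

section \<open>The sample lower bound\<close>

lemma learner_sample_bound:
  assumes learner: "correct_learner m alg" and n: "1 < n"
  shows "\<forall>\<^sub>F N in sequentially.
    9 / 10 * real (n - 1) \<le> 1305856 ^ m N (1 / 10) (0, 1, fib_like n, fib_like (Suc n))"
proof -
  let ?p = "fib_like n" and ?q = "fib_like (Suc n)"
  \<comment> \<open>Both scales and \<open>p\<close> are at most \<open>q\<close>, so this bounds
    \<open>u + p * v\<close> for every \<open>k\<close>. One width \<open>Suc J\<close> and one
    reference \<open>R\<close> then fit the whole family.\<close>
  define J where "J = nat (2 * ?q\<^sup>2 + ?q * (2 * ?q\<^sup>2))"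
  have q: "0 < ?q" by (rule fib_like_pos) simp
  have p: "1 < ?p" "?p < ?q"
    using strict_mono_less[OF strict_mono_fib_like, of 1 n]
      strict_mono_less[OF strict_mono_fib_like, of n "Suc n"] n by auto
  have le: "fib_like i \<le> ?q" "0 \<le> fib_like i" if "i \<le> n" for i
    using strict_mono_less_eq[OF strict_mono_fib_like, of i "Suc n"] that
    by (auto simp: fib_like_nonneg simp del: fib_like.simps)
  obtain R where R: "\<forall>L M \<kappa> x. 2 * (int L)\<^sup>2 + ?p * (2 * (int M)\<^sup>2) \<le> int J \<longrightarrow>
    (\<forall>s. measure_pmf.prob (pair_pmf (fair_binomial L) (fair_binomial M))
      {(u, v). ?q dvd s - (u + ?p * v)} \<le> \<kappa> / ?q) \<longrightarrow>
    pmf (binomial_combination ?p ?q L M (Suc J)) x \<le> 4 * \<kappa> * pmf R x"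
    by (rule binomial_combination_dominated[OF q fib_like_nonneg])
  have dom: "pmf (hypothesis n (Suc J) k) x \<le> 1305856 * pmf R x" if k: "k \<in> {0<..<n}" for k x
  proof -
    have sq: "(fib_like i)\<^sup>2 \<le> ?q\<^sup>2" if "i \<le> n" for i
      using le[OF that] by (intro power_mono) auto
    have "2 * (fib_like (n - k))\<^sup>2 + ?p * (2 * (fib_like k)\<^sup>2) \<le> 2 * ?q\<^sup>2 + ?q * (2 * ?q\<^sup>2)"
      using p q k by (intro add_mono mult_mono mult_left_mono sq) auto
    then have "2 * (int (nat (fib_like (n - k))))\<^sup>2 + ?p * (2 * (int (nat (fib_like k)))\<^sup>2) \<le> int J"
      using le[of "n - k"] le[of k] k by (simp add: J_def del: fib_like.simps)
    then have "pmf (hypothesis n (Suc J) k) x \<le> 4 * 326464 * pmf R x"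
      unfolding hypothesis_def
      using k by (intro R[rule_format] fib_like_residue_le) auto
    then show ?thesis by simp
  qed
  \<comment> \<open>The threshold leaves room for the summands of \<open>U\<close>, \<open>V\<close>
    and \<open>Y\<close> for every \<open>k\<close>, as both scales are at most
    \<open>q\<close>.\<close>
  have "9 / 10 * real (n - 1) \<le> 1305856 ^ m N (1 / 10) (0, 1, ?p, ?q)"
    if N: "4 * (nat ?q)\<^sup>2 + 2 * (Suc J)\<^sup>2 \<le> N" for N
  proof -
    have "9 / 10 * real (card {0<..<n}) \<le> 1305856 ^ m N (1 / 10) (0, 1, ?p, ?q)"
    proof (rule learning_many_dominated_hypotheses[where S = "hypothesis n (Suc J)" and R = R
          and eps = "1 / 10" and alg = "alg N (1 / 10) (0, 1, ?p, ?q)"])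
      fix k assume k: "k \<in> {0<..<n}"
      have sq: "(nat (fib_like i))\<^sup>2 \<le> (nat ?q)\<^sup>2" if "i \<le> n" for i
        using le[OF that] by (intro power_mono) auto
      have "2 * (nat (fib_like (n - k)))\<^sup>2 + 2 * (nat (fib_like k))\<^sup>2 + 2 * (Suc J)\<^sup>2 \<le> N"
        using sq[OF diff_le_self[of n k]] sq[of k] N k by (auto simp del: fib_like.simps power_mono_iff power_increasing_iff power2_nat_le_eq_le)
      then have "is_A_sum {0, 1, ?p, ?q} N (hypothesis n (Suc J) k)"
        unfolding hypothesis_def by (rule is_A_sum_binomial_combination)
      then show "9 / 10 \<le> measure_pmf.prob
          (bind_pmf (iid_pmf (m N (1 / 10) (0, 1, ?p, ?q)) (hypothesis n (Suc J) k))
            (alg N (1 / 10) (0, 1, ?p, ?q))) {H. dTV H (hypothesis n (Suc J) k) \<le> 1 / 10}"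
        using p by (intro learner[unfolded correct_learner_def, rule_format]) (simp del: fib_like.simps)
    qed (use dom hypothesis_far in auto)
    then show ?thesis by simp
  qed
  then show ?thesis unfolding eventually_sequentially by blast
qed

text \<open>\<open>ln q\<close> is at most linear in \<open>n\<close>. Bounding it by a square
  absorbs all constants once \<open>n >= 200\<close> and costs only a factor 2 after the outer
  logarithm.\<close>

lemma ln_ln_fib_like_le:
  assumes n: "200 \<le> n"
  shows "ln (ln (real_of_int (fib_like (Suc n)))) \<le> 2 * ln (9 / 10 * real (n - 1))"
proof -
  let ?q = "real_of_int (fib_like (Suc n))"
  have q1: "1 < fib_like (Suc n)"
    using strict_mono_less[OF strict_mono_fib_like, of 1 "Suc n"] n by (simp del: fib_like.simps(3))
  then have q1': "1 < ?q" by linarith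
  have "?q \<le> real_of_int (101 ^ Suc n)" using fib_like_le_power[of "Suc n"] by linarith
  then have "ln ?q \<le> ln (101 ^ Suc n)" using q1' by (subst ln_le_cancel_iff) auto
  also have "\<dots> = (real n + 1) * ln 101" by (subst ln_realpow) (auto simp: algebra_simps)
  also have "\<dots> \<le> (real n + 1) * 100" using ln_le_minus_one[of 101] by (intro mult_left_mono) auto
  also have "\<dots> \<le> (9 / 10 * real (n - 1))\<^sup>2"
  proof -
    define x where "x = real (n - 1)"
    have x: "199 \<le> x" "real n = x + 1" using n by (auto simp: x_def)
    have "(real n + 1) * 100 \<le> 81 / 100 * (199 * x)" using x by simp
    also have "\<dots> \<le> 81 / 100 * (x * x)" using x by (intro mult_left_mono mult_right_mono) auto
    finally show ?thesis unfolding x_def[symmetric] by (simp add: power2_eq_square)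
  qed
  finally have "ln (ln ?q) \<le> ln ((9 / 10 * real (n - 1))\<^sup>2)"
    using q1' n by (subst ln_le_cancel_iff) auto
  also have "\<dots> = 2 * ln (9 / 10 * real (n - 1))" using n by (subst ln_realpow) auto
  finally show ?thesis .
qed

theorem theorem5:
  shows "\<exists>c > 0. \<exists>eps0 > 0. \<forall>m alg. correct_learner m alg \<longrightarrow>
    infinite {(a1 :: int, a2 :: int, a3 :: int, a4 :: int).
      0 \<le> a1 \<and> a1 < a2 \<and> a2 < a3 \<and> a3 < a4 \<and>
      (\<forall>\<^sub>F N in sequentially.
         real (m N eps0 (a1, a2, a3, a4)) \<ge> c * ln (ln (real_of_int a4)))}"
proof -
  \<comment> \<open>\<open>C\<close> is 4 times the residue constant 326464. From
    \<open>9 / 10 * (n - 1) <= C ^ m\<close> follows \<open>ln (ln q) <= 2 m ln C\<close>, which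
    dictates \<open>c\<close>; neither constant depends on the learner.\<close>
  define C :: real where "C = 1305856"
  define c where "c = 1 / (2 * ln C)"
  have C: "0 < ln C" by (simp add: C_def)
  then have c: "0 < c" by (simp add: c_def)
  have "infinite {(a1 :: int, a2 :: int, a3 :: int, a4 :: int).
      0 \<le> a1 \<and> a1 < a2 \<and> a2 < a3 \<and> a3 < a4 \<and>
      (\<forall>\<^sub>F N in sequentially.
         real (m N (1 / 10) (a1, a2, a3, a4)) \<ge> c * ln (ln (real_of_int a4)))}" (is "infinite ?S")
    if learner: "correct_learner m alg" for m alg
  proof -
    define g where "g n = (0 :: int, 1 :: int, fib_like n, fib_like (Suc n))" for n
    have "g n \<in> ?S" if n: "200 \<le> n" for n
    proof -
      have "\<forall>\<^sub>F N in sequentially. 9 / 10 * real (n - 1) \<le> C ^ m N (1 / 10) (g n)"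
        unfolding g_def C_def by (rule learner_sample_bound[OF learner]) (use n in simp)
      then have "\<forall>\<^sub>F N in sequentially.
          c * ln (ln (real_of_int (fib_like (Suc n)))) \<le> real (m N (1 / 10) (g n))"
      proof eventually_elim
        case (elim N)
        have "ln (9 / 10 * real (n - 1)) \<le> ln (C ^ m N (1 / 10) (g n))"
          using elim n by (subst ln_le_cancel_iff) (auto simp: C_def)
        also have "\<dots> = real (m N (1 / 10) (g n)) * ln C" by (simp add: ln_realpow C_def)
        finally have "ln (ln (real_of_int (fib_like (Suc n)))) \<le> 2 * (real (m N (1 / 10) (g n)) * ln C)"
          using ln_ln_fib_like_le[OF n] by linarith
        then show ?case using C by (simp add: c_def field_simps del: fib_like.simps)
      qed
      moreover have "1 < fib_like n" "fib_like n < fib_like (Suc n)"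
        using strict_mono_less[OF strict_mono_fib_like, of 1 n]
          strict_mono_less[OF strict_mono_fib_like, of n "Suc n"] n by auto
      ultimately show ?thesis by (simp add: g_def del: fib_like.simps)
    qed
    then have "g ` {200..} \<subseteq> ?S" by (intro image_subsetI) (simp only: atLeast_iff)
    moreover have "inj_on g {200..}"
      using strict_mono_imp_inj_on[OF strict_mono_fib_like] by (auto simp: g_def inj_on_def)
    then have "infinite (g ` {200..})" by (simp add: finite_image_iff infinite_Ici)
    ultimately show ?thesis using infinite_super by blast
  qed
  then show ?thesis using c by (intro exI[of _ c] exI[of _ "1 / 10"] conjI) auto
qed

end
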